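(* Let $n\ge 2$. A nonempty subgraph $G\subset K_n$ (i.e. one with nonempty edge set) corresponds to an arrangement of smallest minors in $Gr^+(2,n)$ if and only if every pair of edges in $G$ is non-crossing, or they share a common vertex.
   Context: $K_n$ is the complete graph on the vertices $1,\dots,n$, which are placed on a circle in clockwise order. Two-element subsets $\{i,j\}$ of $[n]=\{1,\dots,n\}$ are identified with edges of $K_n$, so a set of two-element subsets of $[n]$ is identified with a subgraph of $K_n$ (its edge set). For distinct $a,b,c,d$, the edges $\{a,b\}$ and $\{c,d\}$ are non-crossing if the straight-line chords $[a,b]$ and $[c,d]$ in the circle do not cross, and crossing otherwise. $Gr^+(2,n)$, the positive Grassmannian, is the space of real $2\times n$ matrices of rank $2$, modulo row operations, all of whose $2\times 2$ minors $\Delta_{ij}$ ($i<j$, in columns $i,j$; defined up to a common nonzero factor) have the same nonzero sign; we choose representatives with all $\Delta_{ij}>0$. A set $\mathcal{J}$ of two-element subsets of $[n]$ is an arrangement of smallest minors in $Gr^+(2,n)$ if it is nonempty and there is a point of $Gr^+(2,n)$ at which all $\Delta_I$, $I\in\mathcal{J}$, are equal to each other and $\Delta_K>\Delta_I$ for all $I\in\mathcal{J}$ and all two-element subsets $K\notin\mathcal{J}$. *)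

theory Defs
  imports "Jordan_Normal_Form.DL_Rank" "Jordan_Normal_Form.DL_Submatrix" "HOL-Analysis.Convex"
begin

definition edges :: "nat \<Rightarrow> nat set set" where
  "edges n = {e. e \<subseteq> {1..n} \<and> card e = 2}"

(* The points p 1, ..., p n lie in clockwise order on some circle; their angles decrease because
   the argument of a complex number is measured counterclockwise. *)
definition clockwise_on_circle :: "nat \<Rightarrow> (nat \<Rightarrow> complex) \<Rightarrow> bool" where
  "clockwise_on_circle n p \<longleftrightarrow>
    (\<exists>(c :: complex) (r :: real) (\<theta> :: nat \<Rightarrow> real). r > 0 \<and>
       (\<forall>i\<in>{1..n}. p i = c + of_real r * cis (\<theta> i)) \<and>
       (\<forall>i\<in>{1..n}. \<forall>j\<in>{1..n}. i < j \<longrightarrow> \<theta> j < \<theta> i \<and> \<theta> i < \<theta> j + 2 * pi))"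

lemma clockwise_on_circle_regular:
  "clockwise_on_circle n (\<lambda>i. cis (- (2 * pi * real i / real n)))"
  unfolding clockwise_on_circle_def
proof (intro exI[of _ "0 :: complex"] exI[of _ "1 :: real"] exI[of _ "\<lambda>i. - (2 * pi * real i / real n)"] conjI ballI impI)
  fix i j assume ij: "i \<in> {1..n}" "j \<in> {1..n}" "i < j"
  then have "(real j - real i) / real n < 1" "(real j - real i) / real n > 0"
    by (auto simp: divide_less_eq)
  then have "2 * pi * ((real j - real i) / real n) < 2 * pi * 1"
    "2 * pi * ((real j - real i) / real n) > 0"
    by (intro mult_strict_left_mono mult_pos_pos; simp)+
  then show "- (2 * pi * real j / real n) < - (2 * pi * real i / real n)"
    "- (2 * pi * real i / real n) < - (2 * pi * real j / real n) + 2 * pi"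
    by (simp_all add: diff_divide_distrib right_diff_distrib)
qed simp_all

(* For e = {a, b} this is the straight segment [p a, p b]. *)
definition chord :: "(nat \<Rightarrow> complex) \<Rightarrow> nat set \<Rightarrow> complex set" where
  "chord p e = convex hull (p ` e)"

(* Only meaningful for disjoint edges: chords with a common vertex always meet. *)
definition non_crossing :: "(nat \<Rightarrow> complex) \<Rightarrow> nat set \<Rightarrow> nat set \<Rightarrow> bool" where
  "non_crossing p e f \<longleftrightarrow> chord p e \<inter> chord p f = {}"

(* The minor in the columns I, numbered from 1, whereas matrix columns are numbered from 0.  The function submatrix keeps the
   selected columns in increasing order. *)
definition minor2 :: "real mat \<Rightarrow> nat set \<Rightarrow> real" where
  "minor2 A I = det (submatrix A UNIV ((\<lambda>i. i - 1) ` I))"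

lemma det_two_by_two:
  fixes M :: "real mat"
  assumes M: "M \<in> carrier_mat 2 2"
  shows "det M = M $$ (0, 0) * M $$ (1, 1) - M $$ (0, 1) * M $$ (1, 0)"
proof -
  have d: "det (mat_delete M 0 j) = mat_delete M 0 j $$ (0, 0)" for j
    by (rule det_single) (use M in \<open>auto simp: mat_delete_def\<close>)
  have "det M = (\<Sum>j<2. M $$ (0, j) * cofactor M 0 j)"
    using laplace_expansion_row[OF M, of 0] by simp
  then show ?thesis
    using M by (simp add: numeral_2_eq_2 cofactor_def d) (simp add: mat_delete_def)
qed

lemma minor2_eq:
  assumes A: "A \<in> carrier_mat 2 n" and ij: "1 \<le> i" "i < j" "j \<le> n"
  shows "minor2 A {i, j} =
    A $$ (0, i - 1) * A $$ (1, j - 1) - A $$ (0, j - 1) * A $$ (1, i - 1)"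
proof -
  let ?J = "{i - 1, j - 1}"
  have J: "(\<lambda>i. i - 1) ` {i, j} = ?J" by simp
  have "{k. k < dim_col A \<and> k \<in> ?J} = ?J" using A ij by auto
  then have c: "card {k. k < dim_col A \<and> k \<in> ?J} = 2" using ij by simp
  have r: "card {k. k < dim_row A \<and> k \<in> (UNIV :: nat set)} = 2" using A by simp
  have p0: "pick ?J 0 = i - 1" using ij by (auto intro!: Least_equality)
  have p1: "pick ?J 1 = j - 1"
    unfolding One_nat_def DL_Missing_Sublist.pick.simps(2) p0[unfolded One_nat_def]
    using ij by (intro Least_equality) auto
  have S: "submatrix A UNIV ?J \<in> carrier_mat 2 2"
    by (rule carrier_matI) (simp_all only: dim_submatrix r c)
  have entry: "submatrix A UNIV ?J $$ (k, l) = A $$ (k, pick ?J l)" if "k < 2" "l < 2" for k l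
    using submatrix_index[of k A UNIV l ?J] that by (simp only: r c pick_UNIV)
  have e: "submatrix A UNIV ?J $$ (0, 0) = A $$ (0, i - 1)"
    "submatrix A UNIV ?J $$ (0, 1) = A $$ (0, j - 1)"
    "submatrix A UNIV ?J $$ (1, 0) = A $$ (1, i - 1)"
    "submatrix A UNIV ?J $$ (1, 1) = A $$ (1, j - 1)"
    using entry[of 0 0, unfolded p0] entry[of 0 1, unfolded p1]
      entry[of 1 0, unfolded p0] entry[of 1 1, unfolded p1] by linarith+
  show ?thesis
    unfolding minor2_def J det_two_by_two[OF S] e ..
qed

definition full_rank_mats :: "nat \<Rightarrow> real mat set" where
  "full_rank_mats n = {A \<in> carrier_mat 2 n. vec_space.rank 2 A = 2}"

definition row_equiv :: "nat \<Rightarrow> real mat rel" where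
  "row_equiv n = {(A, B). A \<in> full_rank_mats n \<and> B \<in> full_rank_mats n \<and>
     (\<exists>C \<in> carrier_mat 2 2. invertible_mat C \<and> B = C * A)}"

lemma invertible_mat2_inverse:
  fixes C :: "real mat"
  assumes C: "C \<in> carrier_mat 2 2" and inv: "invertible_mat C"
  obtains D where "D \<in> carrier_mat 2 2" "C * D = 1\<^sub>m 2" "D * C = 1\<^sub>m 2" "invertible_mat D"
proof -
  from C inv obtain D where D: "C * D = 1\<^sub>m 2" "D * C = 1\<^sub>m (dim_row D)"
    by (auto simp: invertible_mat_def inverts_mat_def)
  have "dim_row D = 2" using arg_cong[OF D(2), of dim_col] C by simp
  moreover have "dim_col D = 2" using arg_cong[OF D(1), of dim_col] by simp
  ultimately have Dc: "D \<in> carrier_mat 2 2" by auto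
  moreover have "D * C = 1\<^sub>m 2" using D(2) Dc by simp
  moreover have "invertible_mat D"
    unfolding invertible_mat_def inverts_mat_def square_mat.simps
    using Dc C D(1) \<open>D * C = 1\<^sub>m 2\<close> by (intro conjI exI[of _ C]) auto
  ultimately show ?thesis using that D(1) by blast
qed

lemma invertible_mat_mult2:
  fixes C D :: "real mat"
  assumes D: "D \<in> carrier_mat 2 2" "invertible_mat D" and C: "C \<in> carrier_mat 2 2" "invertible_mat C"
  shows "invertible_mat (D * C)"
proof -
  obtain C' where C': "C' \<in> carrier_mat 2 2" "C * C' = 1\<^sub>m 2" "C' * C = 1\<^sub>m 2"
    using invertible_mat2_inverse[OF C] by blast
  obtain D' where D': "D' \<in> carrier_mat 2 2" "D * D' = 1\<^sub>m 2" "D' * D = 1\<^sub>m 2"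
    using invertible_mat2_inverse[OF D] by blast
  have "(D * C) * (C' * D') = D * ((C * C') * D')"
    using C(1) D(1) C'(1) D'(1) by (simp add: assoc_mult_mat[of _ 2 2 _ 2 _ 2])
  then have 1: "(D * C) * (C' * D') = 1\<^sub>m 2" using C' D' by simp
  have "(C' * D') * (D * C) = C' * ((D' * D) * C)"
    using C(1) D(1) C'(1) D'(1) by (simp add: assoc_mult_mat[of _ 2 2 _ 2 _ 2])
  then have 2: "(C' * D') * (D * C) = 1\<^sub>m 2" using C' D' C by simp
  show ?thesis
    unfolding invertible_mat_def inverts_mat_def square_mat.simps
    using C(1) D(1) C'(1) D'(1) 1 2 by (intro conjI exI[of _ "C' * D'"]) auto
qed

lemma equiv_row_equiv: "equiv (full_rank_mats n) (row_equiv n)"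
proof (rule equivI)
  show "row_equiv n \<subseteq> full_rank_mats n \<times> full_rank_mats n"
    by (auto simp: row_equiv_def)
  show "refl_on (full_rank_mats n) (row_equiv n)"
  proof (rule refl_onI)
    fix A assume A: "A \<in> full_rank_mats n"
    then have "A = 1\<^sub>m 2 * A" by (auto simp: full_rank_mats_def)
    moreover have "invertible_mat (1\<^sub>m 2 :: real mat)"
      unfolding invertible_mat_def inverts_mat_def square_mat.simps
      by (intro conjI exI[of _ "1\<^sub>m 2"]) auto
    ultimately show "(A, A) \<in> row_equiv n"
      using A by (auto simp: row_equiv_def intro!: bexI[of _ "1\<^sub>m 2"])
  qed
  show "sym (row_equiv n)"
  proof (rule symI)
    fix A B assume "(A, B) \<in> row_equiv n"
    then obtain C where *: "A \<in> full_rank_mats n" "B \<in> full_rank_mats n"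
      "C \<in> carrier_mat 2 2" "invertible_mat C" "B = C * A"
      by (auto simp: row_equiv_def)
    have A: "A \<in> carrier_mat 2 n" using *(1) by (simp add: full_rank_mats_def)
    obtain D where D: "D \<in> carrier_mat 2 2" "C * D = 1\<^sub>m 2" "D * C = 1\<^sub>m 2" "invertible_mat D"
      using invertible_mat2_inverse[OF *(3,4)] by blast
    have "D * B = (D * C) * A"
      unfolding *(5) by (rule assoc_mult_mat[symmetric, OF D(1) *(3) A])
    then have "A = D * B" using A D(3) by simp
    then show "(B, A) \<in> row_equiv n"
      using * D(1,4) by (auto simp: row_equiv_def simp del: One_nat_def intro!: bexI[of _ D])
  qed
  show "trans (row_equiv n)"
  proof (rule transI)
    fix A B E assume "(A, B) \<in> row_equiv n" "(B, E) \<in> row_equiv n"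
    then obtain C D where *: "A \<in> full_rank_mats n" "E \<in> full_rank_mats n"
      "C \<in> carrier_mat 2 2" "invertible_mat C" "D \<in> carrier_mat 2 2" "invertible_mat D"
      "E = D * (C * A)"
      by (auto simp: row_equiv_def)
    have "A \<in> carrier_mat 2 n" using *(1) by (simp add: full_rank_mats_def)
    then have "E = (D * C) * A" using * by simp
    moreover have "invertible_mat (D * C)"
      using invertible_mat_mult2[OF *(5,6,3,4)] .
    ultimately show "(A, E) \<in> row_equiv n"
      using * by (auto simp: row_equiv_def intro!: bexI[of _ "D * C"])
  qed
qed

definition Gr2 :: "nat \<Rightarrow> real mat set set" where
  "Gr2 n = full_rank_mats n // row_equiv n"

definition Gr2_pos :: "nat \<Rightarrow> real mat set set" where
  "Gr2_pos n = {P \<in> Gr2 n. \<forall>A\<in>P.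
     (\<forall>I\<in>edges n. minor2 A I > 0) \<or> (\<forall>I\<in>edges n. minor2 A I < 0)}"

(* Minors are compared at a representative A with all minors positive; any other such
   representative of P rescales all minors by a common positive factor. *)
definition smallest_minors_arrangement :: "nat \<Rightarrow> nat set set \<Rightarrow> bool" where
  "smallest_minors_arrangement n J \<longleftrightarrow> J \<subseteq> edges n \<and> J \<noteq> {} \<and>
     (\<exists>P\<in>Gr2_pos n. \<exists>A\<in>P. (\<forall>I\<in>edges n. minor2 A I > 0) \<and>
        (\<forall>I\<in>J. \<forall>I'\<in>J. minor2 A I = minor2 A I') \<and>
        (\<forall>I\<in>J. \<forall>K\<in>edges n - J. minor2 A K > minor2 A I))"

end

theory Submission
  imports Defs "HOL-Analysis.Line_Segment" "Jordan_Normal_Form.DL_Rank_Submatrix"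
begin

text \<open>
  Two disjoint chords of a circle meet exactly when their endpoints alternate around the circle
  (\<open>interleaving_free_iff_non_crossing\<close>), so the condition on \<open>G\<close> is purely combinatorial: no
  \<open>a < b < c < d\<close> have both \<open>{a, c}\<close> and \<open>{b, d}\<close> in \<open>G\<close>.

  This condition is necessary by the Pluecker relation
  \<open>\<Delta>\<^sub>a\<^sub>c \<Delta>\<^sub>b\<^sub>d = \<Delta>\<^sub>a\<^sub>b \<Delta>\<^sub>c\<^sub>d + \<Delta>\<^sub>a\<^sub>d \<Delta>\<^sub>b\<^sub>c\<close>: if both factors on the left equalled the
  smallest minor \<open>m > 0\<close>, the left side would be \<open>m\<^sup>2\<close> and the right side at least \<open>2 m\<^sup>2\<close>.

  For sufficiency one needs vectors \<open>z\<^sub>1, \<dots>, z\<^sub>n\<close> in the plane with \<open>det (z\<^sub>i, z\<^sub>j) = 1\<close> for the edges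
  \<open>{i, j}\<close> of \<open>G\<close> and \<open>det (z\<^sub>i, z\<^sub>j) > 1\<close> for all other pairs \<open>i < j\<close>
  (\<open>ex_vectors_with_unit_dets\<close>). They are built by induction on the number of vertices. A
  crossing-free graph has a vertex \<open>v\<close>, neither the first nor the last one, that is joined at most to the
  vertices \<open>u\<close> and \<open>w\<close> next to it (\<open>ex_vertex_joined_only_to_neighbours\<close>). Given the vectors of the other
  vertices, put \<open>z\<^sub>v = \<alpha> z\<^sub>u + \<beta> z\<^sub>w\<close>. The coefficients are determined by the wanted values of
  \<open>det (z\<^sub>u, z\<^sub>v) = \<beta> det (z\<^sub>u, z\<^sub>w)\<close> and \<open>det (z\<^sub>v, z\<^sub>w) = \<alpha> det (z\<^sub>u, z\<^sub>w)\<close>, which may be chosen as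
  \<open>1\<close> on an edge and \<open>3/2\<close> otherwise. All remaining determinants with \<open>z\<^sub>v\<close> are at least
  \<open>\<alpha> + \<beta> \<ge> 2 / det (z\<^sub>u, z\<^sub>w)\<close>, which exceeds \<open>1\<close> as soon as \<open>det (z\<^sub>u, z\<^sub>w) < 2\<close>. Hence the
  induction also keeps the determinants of consecutive vertices below \<open>2\<close>.
\<close>

section \<open>Crossing chords of a circle\<close>

text \<open>Twice the signed area of the triangle \<open>u v w\<close>, positive if the triangle is traversed clockwise.\<close>

definition cw_area :: "complex \<Rightarrow> complex \<Rightarrow> complex \<Rightarrow> real" where
  "cw_area u v w = (Re w - Re u) * (Im v - Im u) - (Re v - Re u) * (Im w - Im u)"

text \<open>The factors are sines of half central angles, which lie between \<open>0\<close> and \<open>\<pi>\<close> for points in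
  clockwise order; so the product form makes the sign visible.\<close>

lemma cw_area_on_circle:
  fixes c :: complex and r \<alpha> \<beta> \<gamma> :: real
  shows "cw_area (c + of_real r * cis \<alpha>) (c + of_real r * cis \<beta>) (c + of_real r * cis \<gamma>) =
    4 * r\<^sup>2 * sin ((\<alpha> - \<beta>) / 2) * sin ((\<beta> - \<gamma>) / 2) * sin ((\<alpha> - \<gamma>) / 2)"
proof -
  define s t where "s = (\<alpha> - \<beta>) / 2" and "t = (\<beta> - \<gamma>) / 2"
  have st: "\<alpha> - \<beta> = 2 * s" "\<beta> - \<gamma> = 2 * t" "\<alpha> - \<gamma> = 2 * (s + t)"
    and half: "(\<alpha> - \<beta>) / 2 = s" "(\<beta> - \<gamma>) / 2 = t" "(\<alpha> - \<gamma>) / 2 = s + t"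
    by (simp_all add: s_def t_def field_simps)
  have "cw_area (c + of_real r * cis \<alpha>) (c + of_real r * cis \<beta>) (c + of_real r * cis \<gamma>) =
      r\<^sup>2 * (sin (\<alpha> - \<beta>) + sin (\<beta> - \<gamma>) - sin (\<alpha> - \<gamma>))"
    by (simp add: cw_area_def sin_diff power2_eq_square algebra_simps)
  also have "sin (\<alpha> - \<beta>) + sin (\<beta> - \<gamma>) - sin (\<alpha> - \<gamma>) = 4 * sin s * sin t * sin (s + t)"
  proof -
    have "sin (2 * s) + sin (2 * t) = 2 * sin (s + t) * cos (s - t)"
    proof -
      have "(2 * s + 2 * t) / 2 = s + t" "(2 * s - 2 * t) / 2 = s - t"
        by (simp_all add: field_simps)
      then show ?thesis
        using sin_plus_sin[of "2 * s" "2 * t"] by (simp only:)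
    qed
    moreover have "sin (2 * (s + t)) = 2 * sin (s + t) * cos (s + t)"
      by (rule sin_double)
    ultimately have "sin (2 * s) + sin (2 * t) - sin (2 * (s + t)) =
        2 * sin (s + t) * (cos (s - t) - cos (s + t))"
      by (simp add: right_diff_distrib)
    also have "cos (s - t) - cos (s + t) = 2 * sin s * sin t"
      by (simp add: cos_diff cos_add)
    finally show ?thesis
      unfolding st by simp
  qed
  finally show ?thesis
    by (simp only: half mult_ac)
qed

lemma cw_area_pos:
  assumes p: "clockwise_on_circle n p" and ijk: "1 \<le> i" "i < j" "j < k" "k \<le> n"
  shows "cw_area (p i) (p j) (p k) > 0"
proof -
  obtain c r \<theta> where r: "r > 0"
    and p_eq: "\<forall>i\<in>{1..n}. p i = c + of_real r * cis (\<theta> i)"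
    and \<theta>: "\<forall>i\<in>{1..n}. \<forall>j\<in>{1..n}. i < j \<longrightarrow> \<theta> j < \<theta> i \<and> \<theta> i < \<theta> j + 2 * pi"
    using p unfolding clockwise_on_circle_def by blast
  have pos: "sin ((\<theta> a - \<theta> b) / 2) > 0" if "1 \<le> a" "a < b" "b \<le> n" for a b
    by (rule sin_gt_zero) (use \<theta>[rule_format, of a b] that in auto)
  show ?thesis
    using p_eq ijk r pos[of i j] pos[of j k] pos[of i k]
    by (simp add: cw_area_on_circle)
qed

lemma cw_area_convex_combination:
  "cw_area u v ((1 - t) *\<^sub>R x + t *\<^sub>R y) = (1 - t) * cw_area u v x + t * cw_area u v y"
  by (simp add: cw_area_def algebra_simps)

text \<open>\<open>cw_area u v\<close> is an affine function that vanishes on the line through \<open>u\<close> and \<open>v\<close>. If it has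
  the same strict sign at \<open>x\<close> and \<open>y\<close>, it has no zero between them.\<close>

lemma segments_disjoint_if_same_side:
  assumes "cw_area u v x * cw_area u v y > 0"
  shows "closed_segment u v \<inter> closed_segment x y = {}"
proof -
  have False if z: "z \<in> closed_segment u v" "z \<in> closed_segment x y" for z
  proof -
    obtain s where s: "z = (1 - s) *\<^sub>R u + s *\<^sub>R v"
      using z(1) by (auto simp: in_segment)
    obtain t where t: "0 \<le> t" "t \<le> 1" "z = (1 - t) *\<^sub>R x + t *\<^sub>R y"
      using z(2) by (auto simp: in_segment)
    have "cw_area u v z = 0"
      unfolding s cw_area_convex_combination by (simp add: cw_area_def)
    then have 0: "(1 - t) * cw_area u v x + t * cw_area u v y = 0"
      unfolding t(3) cw_area_convex_combination .
    show False
    proof (cases "cw_area u v x > 0")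
      case True
      then have "cw_area u v y > 0"
        using assms zero_less_mult_pos by blast
      then show False
        using convex_bound_lt[of "- cw_area u v x" 0 "- cw_area u v y" "1 - t" t] True t 0 by simp
    next
      case False
      then have "cw_area u v x < 0" "cw_area u v y < 0"
        using assms by (auto simp: zero_less_mult_iff)
      then show False
        using convex_bound_lt[of "cw_area u v x" 0 "cw_area u v y" "1 - t" t] t 0 by simp
    qed
  qed
  then show ?thesis by blast
qed

text \<open>Write \<open>[xyz]\<close> for \<open>cw_area x y z\<close>. Four points of the plane satisfy the affine relation
  \<open>[bcd] a + [abd] c = [acd] b + [abc] d\<close>, where \<open>[bcd] + [abd] = [acd] + [abc]\<close>. If all four areas
  are positive, dividing by the common weight \<open>S\<close> exhibits one point on both diagonals.\<close>

lemma diagonals_meet: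
  assumes pos: "cw_area a b c > 0" "cw_area b c d > 0" "cw_area a c d > 0" "cw_area a b d > 0"
  shows "closed_segment a c \<inter> closed_segment b d \<noteq> {}"
proof -
  define S where "S = cw_area b c d + cw_area a b d"
  have S: "S > 0" "S = cw_area a c d + cw_area a b c"
    using pos by (simp_all add: S_def cw_area_def algebra_simps)
  define t s where "t = cw_area a b d / S" and "s = cw_area a b c / S"
  have t: "0 \<le> t" "t \<le> 1" and s: "0 \<le> s" "s \<le> 1"
    using pos S S_def by (simp_all add: t_def s_def)
  have t': "1 - t = cw_area b c d / S" and s': "1 - s = cw_area a c d / S"
    using S(1) S_def S(2) by (simp_all add: t_def s_def field_simps)
  have "(1 - t) *\<^sub>R a + t *\<^sub>R c = (1 - s) *\<^sub>R b + s *\<^sub>R d"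
    unfolding t' s' unfolding t_def s_def
    by (rule complex_eqI; simp add: add_divide_distrib[symmetric] del: add_divide_distrib)
      (simp_all add: cw_area_def algebra_simps)
  moreover have "(1 - t) *\<^sub>R a + t *\<^sub>R c \<in> closed_segment a c"
    using t by (auto simp: in_segment)
  moreover have "(1 - s) *\<^sub>R b + s *\<^sub>R d \<in> closed_segment b d"
    using s by (auto simp: in_segment)
  ultimately show ?thesis by auto
qed

lemma chord_eq_closed_segment: "chord p {a, b} = closed_segment (p a) (p b)"
  by (simp add: chord_def segment_convex_hull)

lemma interleaved_chords_meet:
  assumes p: "clockwise_on_circle n p" and "1 \<le> a" "a < b" "b < c" "c < d" "d \<le> n"
  shows "\<not> non_crossing p {a, c} {b, d}"
  unfolding non_crossing_def chord_eq_closed_segment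
  by (rule diagonals_meet) (use assms in \<open>auto intro!: cw_area_pos[OF p]\<close>)

lemma edgesE:
  assumes "e \<in> edges n"
  obtains a b where "e = {a, b}" "1 \<le> a" "a < b" "b \<le> n"
proof -
  obtain x y where "e = {x, y}" "x \<noteq> y" "e \<subseteq> {1..n}"
    using assms by (auto simp: edges_def card_2_iff)
  then show ?thesis
    using that[of x y] that[of y x] by (cases "x < y") (auto simp: insert_commute)
qed

lemma pair_in_edges_iff: "a < b \<Longrightarrow> {a, b} \<in> edges n \<longleftrightarrow> 1 \<le> a \<and> b \<le> n"
  by (auto simp: edges_def)

text \<open>If the endpoints do not alternate, \<open>c\<close> and \<open>d\<close> lie on the same arc cut off by \<open>a\<close> and \<open>b\<close>,
  hence on the same side of the chord.\<close>

lemma meeting_chords_interleaved: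
  assumes p: "clockwise_on_circle n p" and ab: "1 \<le> a" "a < b" "b \<le> n" and cd: "c < d" "d \<le> n"
    and ac: "a < c" and disj: "{a, b} \<inter> {c, d} = {}" and meet: "\<not> non_crossing p {a, b} {c, d}"
  shows "c < b \<and> b < d"
proof (rule ccontr)
  assume not_interleaved: "\<not> (c < b \<and> b < d)"
  have swap: "cw_area u v w = - cw_area u w v" for u v w
    by (simp add: cw_area_def)
  have "cw_area (p a) (p b) (p c) * cw_area (p a) (p b) (p d) > 0"
  proof (cases "c < b")
    case True
    then have "d < b" using not_interleaved disj by auto
    then have "cw_area (p a) (p c) (p b) > 0" "cw_area (p a) (p d) (p b) > 0"
      using assms True by (auto intro!: cw_area_pos[OF p])
    then show ?thesis
      unfolding swap[of "p a" "p b"] by simp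
  next
    case False
    then have "b < c" using disj by auto
    then have "cw_area (p a) (p b) (p c) > 0" "cw_area (p a) (p b) (p d) > 0"
      using assms by (auto intro!: cw_area_pos[OF p])
    then show ?thesis by simp
  qed
  then show False
    using segments_disjoint_if_same_side meet
    by (auto simp: non_crossing_def chord_eq_closed_segment)
qed

definition interleaving_free :: "nat set \<Rightarrow> nat set set \<Rightarrow> bool" where
  "interleaving_free V G \<longleftrightarrow> (\<forall>a\<in>V. \<forall>b\<in>V. \<forall>c\<in>V. \<forall>d\<in>V.
     a < b \<longrightarrow> b < c \<longrightarrow> c < d \<longrightarrow> {a, c} \<in> G \<longrightarrow> {b, d} \<notin> G)"

lemma interleaving_free_iff_non_crossing:
  assumes p: "clockwise_on_circle n p" and G: "G \<subseteq> edges n"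
  shows "interleaving_free {1..n} G \<longleftrightarrow>
    (\<forall>e\<in>G. \<forall>f\<in>G. e \<noteq> f \<longrightarrow> non_crossing p e f \<or> e \<inter> f \<noteq> {})"
proof
  assume free: "interleaving_free {1..n} G"
  have False if ef: "e \<in> G" "f \<in> G" "\<not> non_crossing p e f" "e \<inter> f = {}" for e f
  proof -
    obtain a b where e: "e = {a, b}" "1 \<le> a" "a < b" "b \<le> n"
      using ef(1) G edgesE by blast
    obtain c d where f: "f = {c, d}" "1 \<le> c" "c < d" "d \<le> n"
      using ef(2) G edgesE by blast
    have fe: "\<not> non_crossing p f e" "f \<inter> e = {}"
      using ef(3,4) by (auto simp: non_crossing_def Int_commute)
    consider "a < c" | "c < a" using ef(4) e f by force
    then show False
    proof cases
      case 1
      then have "c < b \<and> b < d"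
        using meeting_chords_interleaved[OF p] e f ef by blast
      then show False
        using free[unfolded interleaving_free_def, rule_format, of a c b d] 1 e f ef(1,2) by auto
    next
      case 2
      then have "a < d \<and> d < b"
        using meeting_chords_interleaved[OF p] e f fe by blast
      then show False
        using free[unfolded interleaving_free_def, rule_format, of c a d b] 2 e f ef(1,2) by auto
    qed
  qed
  then show "\<forall>e\<in>G. \<forall>f\<in>G. e \<noteq> f \<longrightarrow> non_crossing p e f \<or> e \<inter> f \<noteq> {}"
    by blast
next
  assume nc: "\<forall>e\<in>G. \<forall>f\<in>G. e \<noteq> f \<longrightarrow> non_crossing p e f \<or> e \<inter> f \<noteq> {}"
  show "interleaving_free {1..n} G"
    unfolding interleaving_free_def
  proof (intro ballI impI notI)
    fix a b c d
    assume abcd: "a \<in> {1..n}" "b \<in> {1..n}" "c \<in> {1..n}" "d \<in> {1..n}" "a < b" "b < c" "c < d"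
      and in_G: "{a, c} \<in> G" "{b, d} \<in> G"
    have "{a, c} \<inter> {b, d} = {}" "{a, c} \<noteq> {b, d}"
      using abcd by auto
    then have "non_crossing p {a, c} {b, d}"
      using nc in_G by blast
    then show False
      using interleaved_chords_meet[OF p, of a b c d] abcd by auto
  qed
qed

section \<open>Prescribing the unit minors\<close>

definition det2 :: "(nat \<Rightarrow> real) \<Rightarrow> (nat \<Rightarrow> real) \<Rightarrow> nat \<Rightarrow> nat \<Rightarrow> real" where
  "det2 x y i j = x i * y j - x j * y i"

lemma interleaving_free_subset:
  "interleaving_free V G \<Longrightarrow> W \<subseteq> V \<Longrightarrow> interleaving_free W G"
  unfolding interleaving_free_def by blast

text \<open>Among the edges that skip some vertex of \<open>V\<close>, take a shortest one \<open>{i, j}\<close>, and let \<open>v\<close> be a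
  skipped vertex. An edge at \<open>v\<close> cannot leave the interval from \<open>i\<close> to \<open>j\<close> without interleaving with
  \<open>{i, j}\<close>; so it is shorter and, by minimality, skips no vertex. The pair of the extreme vertices
  is admitted as a candidate for \<open>{i, j}\<close> even if it is not an edge: nothing can leave its interval,
  and it guarantees that a candidate exists.\<close>

lemma ex_vertex_joined_only_to_neighbours:
  assumes V: "finite V" "l \<in> V" "m \<in> V" "h \<in> V" "l < m" "m < h"
    and free: "interleaving_free V G"
  obtains u v w where "u \<in> V" "v \<in> V" "w \<in> V" "u < v" "v < w"
    "\<forall>k\<in>V. k < v \<longrightarrow> k \<le> u \<and> ({k, v} \<in> G \<longrightarrow> k = u)"
    "\<forall>k\<in>V. v < k \<longrightarrow> w \<le> k \<and> ({v, k} \<in> G \<longrightarrow> k = w)"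
proof -
  define diag where "diag i j \<longleftrightarrow> i \<in> V \<and> j \<in> V \<and> (\<exists>k\<in>V. i < k \<and> k < j) \<and>
      ({i, j} \<in> G \<or> i = Min V \<and> j = Max V)" for i j
  have bounds: "Min V \<le> k" "k \<le> Max V" if "k \<in> V" for k
    using V that by auto
  have "diag (Min V) (Max V)"
  proof -
    have "Min V \<in> V" "Max V \<in> V" using V(1,2) by (auto intro: Min_in Max_in)
    moreover have "Min V < m \<and> m < Max V" using bounds(1)[of l] bounds(2)[of h] V(2,4-6) by linarith
    ultimately show ?thesis using V(3) by (auto simp: diag_def)
  qed
  then obtain i j where ij: "diag i j" and shortest: "\<And>i' j'. diag i' j' \<Longrightarrow> j - i \<le> j' - i'"
    using ex_has_least_nat[of "\<lambda>(i, j). diag i j" "(Min V, Max V)" "\<lambda>(i, j). j - i"] by auto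
  obtain v where v: "v \<in> V" "i < v" "v < j"
    using ij by (auto simp: diag_def)
  define u where "u = Max {k \<in> V. k < v}"
  define w where "w = Min {k \<in> V. v < k}"
  have iV: "i \<in> V" "j \<in> V" using ij by (auto simp: diag_def)
  have "u \<in> {k \<in> V. k < v}"
    unfolding u_def by (rule Max_in) (use V(1) iV v in auto)
  then have u: "u \<in> V" "u < v" by auto
  have u_max: "k \<le> u" if "k \<in> V" "k < v" for k
    unfolding u_def using V(1) that by (intro Max_ge) auto
  have "w \<in> {k \<in> V. v < k}"
    unfolding w_def by (rule Min_in) (use V(1) iV v in auto)
  then have w: "w \<in> V" "v < w" by auto
  have w_min: "w \<le> k" if "k \<in> V" "v < k" for k
    unfolding w_def using V(1) that by (intro Min_le) auto
  show ?thesis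
  proof (rule that[OF u(1) v(1) w(1) u(2) w(2)]; intro ballI impI conjI)
    show "k \<le> u" if "k \<in> V" "k < v" for k
      using u_max that .
    show "w \<le> k" if "k \<in> V" "v < k" for k
      using w_min that .
  next
    fix k assume k: "k \<in> V" "k < v" "{k, v} \<in> G"
    have "i \<le> k"
    proof (rule ccontr)
      assume "\<not> i \<le> k"
      then have "{i, j} \<in> G" "k < i"
        using ij bounds(1)[OF k(1)] by (auto simp: diag_def)
      then show False
        using free k v iV unfolding interleaving_free_def by blast
    qed
    then have "\<not> diag k v"
      using shortest[of k v] v k(2) by auto
    then have "\<not> k < u"
      using k v(1) u by (auto simp: diag_def)
    then show "k = u"
      using u_max[OF k(1,2)] by simp
  next
    fix k assume k: "k \<in> V" "v < k" "{v, k} \<in> G"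
    have "k \<le> j"
    proof (rule ccontr)
      assume "\<not> k \<le> j"
      then have "{i, j} \<in> G" "j < k"
        using ij bounds(2)[OF k(1)] by (auto simp: diag_def)
      then show False
        using free k v iV unfolding interleaving_free_def by blast
    qed
    then have "\<not> diag v k"
      using shortest[of v k] v k(2) by auto
    then have "\<not> w < k"
      using k v(1) w by (auto simp: diag_def)
    then show "k = w"
      using w_min[OF k(1,2)] by simp
  qed
qed

text \<open>The upper bound \<open>2\<close> for consecutive vertices is what the induction needs: after removal of \<open>v\<close>
  its two neighbours become consecutive, and their determinant is the divisor \<open>c\<close> in the
  coefficients \<open>\<alpha>\<close> and \<open>\<beta>\<close>. Arbitrary finite vertex sets avoid renumbering after the removal.\<close>

lemma ex_vectors_with_unit_dets:
  assumes "finite V" "interleaving_free V G"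
  shows "\<exists>x y. \<forall>i\<in>V. \<forall>j\<in>V. i < j \<longrightarrow>
    ({i, j} \<in> G \<longrightarrow> det2 x y i j = 1) \<and> ({i, j} \<notin> G \<longrightarrow> det2 x y i j > 1) \<and>
    ((\<forall>k\<in>V. \<not> (i < k \<and> k < j)) \<longrightarrow> det2 x y i j < 2)"
  using assms
proof (induction V rule: finite_psubset_induct)
  case (psubset V)
  show ?case
  proof (cases "\<exists>l\<in>V. \<exists>m\<in>V. \<exists>h\<in>V. l < m \<and> m < h")
    case False
    \<comment> \<open>With at most two vertices, only the vector of the second one has to be adjusted.\<close>
    define x where "x i = (if i = Min V then 1 else 0 :: real)" for i
    define y where "y i = (if i = Min V then 0 else if {Min V, i} \<in> G then 1 else 3 / 2 :: real)" for i
    have "i = Min V \<and> j \<noteq> Min V" if "i \<in> V" "j \<in> V" "i < j" for i j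
    proof -
      have "Min V \<in> V" "Min V \<le> i"
        using psubset.hyps that Min_in[of V] Min_le[of V i] by blast+
      then have "\<not> Min V < i" using False that by blast
      then show ?thesis using \<open>Min V \<le> i\<close> that by simp
    qed
    then show ?thesis
      by (intro exI[of _ x] exI[of _ y]) (fastforce simp: det2_def x_def y_def)
  next
    case True
    then obtain l m h where lmh: "l \<in> V" "m \<in> V" "h \<in> V" "l < m" "m < h" by blast
    obtain u v w where uvw: "u \<in> V" "v \<in> V" "w \<in> V" "u < v" "v < w"
      and below_v: "\<forall>k\<in>V. k < v \<longrightarrow> k \<le> u \<and> ({k, v} \<in> G \<longrightarrow> k = u)"
      and above_v: "\<forall>k\<in>V. v < k \<longrightarrow> w \<le> k \<and> ({v, k} \<in> G \<longrightarrow> k = w)"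
      by (rule ex_vertex_joined_only_to_neighbours[OF psubset.hyps(1) lmh psubset.prems])
    have "V - {v} \<subset> V" using uvw by blast
    from psubset.IH[OF this interleaving_free_subset[OF psubset.prems]]
    obtain x y where xy: "\<And>i j. i \<in> V - {v} \<Longrightarrow> j \<in> V - {v} \<Longrightarrow> i < j \<Longrightarrow>
      ({i, j} \<in> G \<longrightarrow> det2 x y i j = 1) \<and> ({i, j} \<notin> G \<longrightarrow> det2 x y i j > 1) \<and>
      ((\<forall>k\<in>V - {v}. \<not> (i < k \<and> k < j)) \<longrightarrow> det2 x y i j < 2)"
      by blast
    have ge1: "det2 x y i j \<ge> 1" if "i \<in> V" "j \<in> V" "i < j" "i \<noteq> v" "j \<noteq> v" for i j
      using xy[of i j] that by (cases "{i, j} \<in> G") auto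
    define c where "c = det2 x y u w"
    have uw_consecutive: "\<forall>k\<in>V - {v}. \<not> (u < k \<and> k < w)"
      using below_v above_v by (auto simp: not_less[symmetric] neq_iff)
    have c: "1 \<le> c" "c < 2"
      using ge1[of u w] xy[of u w] uw_consecutive uvw by (auto simp: c_def)
    define g where "g e = (if e \<in> G then 1 else 3 / 2 :: real)" for e
    \<comment> \<open>The values that give \<open>det2 x' y' u v = g {u, v}\<close> and \<open>det2 x' y' v w = g {v, w}\<close> below.\<close>
    define \<alpha> \<beta> where "\<alpha> = g {v, w} / c" and "\<beta> = g {u, v} / c"
    have coeff: "\<alpha> > 1 / 2" "\<beta> > 1 / 2"
      using c by (auto simp: \<alpha>_def \<beta>_def g_def field_simps)
    define x' where "x' = x(v := \<alpha> * x u + \<beta> * x w)"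
    define y' where "y' = y(v := \<alpha> * y u + \<beta> * y w)"
    have old: "det2 x' y' i j = det2 x y i j" if "i \<noteq> v" "j \<noteq> v" for i j
      using that by (simp add: det2_def x'_def y'_def)
    have left: "det2 x' y' k v = \<alpha> * det2 x y k u + \<beta> * det2 x y k w" if "k \<noteq> v" for k
      using that by (simp add: det2_def x'_def y'_def algebra_simps)
    have right: "det2 x' y' v k = \<alpha> * det2 x y u k + \<beta> * det2 x y w k" if "k \<noteq> v" for k
      using that by (simp add: det2_def x'_def y'_def algebra_simps)
    have combination: "\<alpha> * s + \<beta> * t > 1" if "s \<ge> 1" "t \<ge> 1" for s t
    proof -
      have "\<alpha> * 1 \<le> \<alpha> * s" "\<beta> * 1 \<le> \<beta> * t"
        using coeff that by (intro mult_left_mono; simp)+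
      then show ?thesis using coeff by linarith
    qed
    have "({i, j} \<in> G \<longrightarrow> det2 x' y' i j = 1) \<and> ({i, j} \<notin> G \<longrightarrow> det2 x' y' i j > 1) \<and>
      ((\<forall>k\<in>V. \<not> (i < k \<and> k < j)) \<longrightarrow> det2 x' y' i j < 2)"
      if ij: "i \<in> V" "j \<in> V" "i < j" for i j
    proof -
      consider "i \<noteq> v" "j \<noteq> v" | "j = v" "i = u" | "j = v" "i < u" | "i = v" "j = w" | "i = v" "w < j"
        using ij below_v above_v by (metis le_neq_implies_less)
      then show ?thesis
      proof cases
        case 1
        then show ?thesis using xy[of i j] ij by (simp add: old)
      next
        case 2
        have "det2 x' y' u v = g {u, v}"
          using left[of u] uvw c by (simp add: \<beta>_def c_def[symmetric]) (simp add: det2_def)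
        then show ?thesis using 2 by (simp add: g_def)
      next
        case 3
        have "det2 x' y' i v > 1"
          using left[of i] combination ge1[of i u] ge1[of i w] 3 ij uvw by simp
        moreover have "{i, v} \<notin> G" using bspec[OF below_v ij(1)] 3 uvw(4) by simp
        moreover have "\<not> (\<forall>k\<in>V. \<not> (i < k \<and> k < v))" using 3 uvw by blast
        ultimately show ?thesis unfolding 3(1) by blast
      next
        case 4
        have "det2 x' y' v w = g {v, w}"
          using right[of w] uvw c by (simp add: \<alpha>_def c_def[symmetric]) (simp add: det2_def)
        then show ?thesis using 4 by (simp add: g_def)
      next
        case 5
        have "det2 x' y' v j > 1"
          using right[of j] combination ge1[of u j] ge1[of w j] 5 ij uvw by simp
        moreover have "{v, j} \<notin> G" using bspec[OF above_v ij(2)] 5 uvw(5) by simp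
        moreover have "\<not> (\<forall>k\<in>V. \<not> (v < k \<and> k < j))" using 5 uvw by blast
        ultimately show ?thesis unfolding 5(1) by blast
      qed
    qed
    then show ?thesis by blast
  qed
qed

section \<open>Points of the positive Grassmannian\<close>

lemma rank_2_if_minor_nonzero:
  assumes A: "A \<in> carrier_mat 2 n" and I: "I \<in> edges n" and nz: "minor2 A I \<noteq> 0"
  shows "vec_space.rank 2 A = 2"
proof -
  interpret vec_space "TYPE(real)" 2 .
  obtain i j where ij: "I = {i, j}" "1 \<le> i" "i < j" "j \<le> n"
    using I edgesE by blast
  let ?J = "(\<lambda>i. i - 1) ` I"
  have "{k. k < n \<and> k \<in> ?J} = {i - 1, j - 1}"
    using ij by auto
  then have "card {k. k < n \<and> k \<in> ?J} = 2"
    using ij by simp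
  then have "2 \<le> rank A"
    using rank_gt_minor[OF A nz[unfolded minor2_def]] by simp
  moreover have "rank A \<le> 2"
  proof -
    have "set (cols A) \<subseteq> carrier V"
      using cols_dim[of A] A by simp
    then show ?thesis
      using subspace_dim[OF span_is_subspace fin_dim fin_dim_span_cols[OF A]]
      by (simp add: rank_def dim_is_n)
  qed
  ultimately show ?thesis by simp
qed

lemma minor2_row_operation:
  assumes A: "A \<in> carrier_mat 2 n" and C: "C \<in> carrier_mat 2 2" and I: "I \<in> edges n"
  shows "minor2 (C * A) I = det C * minor2 A I"
proof -
  obtain i j where ij: "I = {i, j}" "1 \<le> i" "i < j" "j \<le> n"
    using I edgesE by blast
  have entry: "(C * A) $$ (r, k) = C $$ (r, 0) * A $$ (0, k) + C $$ (r, 1) * A $$ (1, k)"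
    if "r < 2" "k < n" for r k
    using A C that by (simp add: scalar_prod_def numeral_2_eq_2)
  have CA: "C * A \<in> carrier_mat 2 n" using A C by simp
  have k: "i - 1 < n" "j - 1 < n" using ij by auto
  show ?thesis
    unfolding ij(1) minor2_eq[OF A ij(2-4)] minor2_eq[OF CA ij(2-4)] det_two_by_two[OF C]
    using k by (simp add: entry del: One_nat_def) (simp add: algebra_simps)
qed

text \<open>Another representative \<open>C * A\<close> of the class of \<open>A\<close> has all minors multiplied by \<open>det C\<close>, which is
  nonzero; so they still have one common sign.\<close>

lemma ex_positive_point_if_minors_positive:
  assumes n: "n \<ge> 2" and A: "A \<in> carrier_mat 2 n" and pos: "\<And>I. I \<in> edges n \<Longrightarrow> minor2 A I > 0"
  shows "\<exists>P\<in>Gr2_pos n. A \<in> P"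
proof -
  have "{1, 2} \<in> edges n" using n by (simp add: edges_def)
  then have A_full: "A \<in> full_rank_mats n"
    using rank_2_if_minor_nonzero[OF A] pos[of "{1, 2}"] A by (simp add: full_rank_mats_def)
  let ?P = "row_equiv n `` {A}"
  have "(\<forall>I\<in>edges n. minor2 B I > 0) \<or> (\<forall>I\<in>edges n. minor2 B I < 0)" if "B \<in> ?P" for B
  proof -
    have "(A, B) \<in> row_equiv n" using that by blast
    then obtain C where C: "C \<in> carrier_mat 2 2" "invertible_mat C" "B = C * A"
      unfolding row_equiv_def by blast
    obtain D where D: "D \<in> carrier_mat 2 2" "C * D = 1\<^sub>m 2"
      using invertible_mat2_inverse[OF C(1,2)] by blast
    have "det C * det D = 1"
      using det_mult[OF C(1) D(1)] D(2) by simp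
    then have "det C \<noteq> 0" by auto
    then have "det C > 0 \<or> det C < 0" by linarith
    then show ?thesis
      using pos by (auto simp: C(3) minor2_row_operation[OF A C(1)] mult_neg_pos)
  qed
  then have "?P \<in> Gr2_pos n"
    using A_full by (auto simp: Gr2_pos_def Gr2_def quotient_def)
  moreover have "A \<in> ?P"
    using equiv_class_self[OF equiv_row_equiv A_full] .
  ultimately show ?thesis by blast
qed

lemma pluecker_relation:
  assumes A: "A \<in> carrier_mat 2 n" and "1 \<le> a" "a < b" "b < c" "c < d" "d \<le> n"
  shows "minor2 A {a, c} * minor2 A {b, d} =
    minor2 A {a, b} * minor2 A {c, d} + minor2 A {a, d} * minor2 A {b, c}"
  using assms by (simp add: minor2_eq[OF A] del: One_nat_def) (simp add: algebra_simps)

text \<open>In the Pluecker relation for interleaving edges of \<open>G\<close>, the left side is the square of the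
  smallest minor, and each of the two products on the right is at least as large.\<close>

lemma interleaving_free_if_smallest_minors:
  assumes "smallest_minors_arrangement n G"
  shows "interleaving_free {1..n} G"
  unfolding interleaving_free_def
proof (intro ballI impI notI)
  fix a b c d
  assume abcd: "a \<in> {1..n}" "b \<in> {1..n}" "c \<in> {1..n}" "d \<in> {1..n}" "a < b" "b < c" "c < d"
    and in_G: "{a, c} \<in> G" "{b, d} \<in> G"
  obtain P A where P: "P \<in> Gr2_pos n" "A \<in> P"
    and pos: "\<forall>I\<in>edges n. minor2 A I > 0"
    and equal: "\<forall>I\<in>G. \<forall>I'\<in>G. minor2 A I = minor2 A I'"
    and smallest: "\<forall>I\<in>G. \<forall>K\<in>edges n - G. minor2 A K > minor2 A I"
    using assms unfolding smallest_minors_arrangement_def by blast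
  have "A \<in> full_rank_mats n"
    using P in_quotient_imp_subset[OF equiv_row_equiv] by (auto simp: Gr2_pos_def Gr2_def)
  then have A: "A \<in> carrier_mat 2 n" by (simp add: full_rank_mats_def)
  define m where "m = minor2 A {a, c}"
  have m_le: "m \<le> minor2 A K" if "K \<in> edges n" for K
    using equal smallest in_G(1) that unfolding m_def
    by (cases "K \<in> G") (metis order_refl, metis DiffI less_imp_le)
  have edges: "{a, b} \<in> edges n" "{c, d} \<in> edges n" "{a, d} \<in> edges n" "{b, c} \<in> edges n"
    "{a, c} \<in> edges n"
    using abcd by (auto simp: pair_in_edges_iff)
  have "m > 0" using pos edges(5) by (simp add: m_def)
  then have "m * m \<le> minor2 A {a, b} * minor2 A {c, d}" "m * m \<le> minor2 A {a, d} * minor2 A {b, c}"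
    using edges(1-4) pos by (intro mult_mono m_le; simp add: less_imp_le)+
  moreover have "m * m = minor2 A {a, b} * minor2 A {c, d} + minor2 A {a, d} * minor2 A {b, c}"
  proof -
    have "minor2 A {b, d} = m" using equal in_G unfolding m_def by blast
    then show ?thesis
      using pluecker_relation[OF A, of a b c d] abcd by (simp add: m_def)
  qed
  ultimately have "m * m \<le> 0" by linarith
  then show False using \<open>m > 0\<close> by (simp add: mult_le_0_iff)
qed

lemma smallest_minors_if_interleaving_free:
  assumes n: "n \<ge> 2" and G: "G \<subseteq> edges n" "G \<noteq> {}" and free: "interleaving_free {1..n} G"
  shows "smallest_minors_arrangement n G"
proof -
  obtain x y where xy: "\<And>i j. i \<in> {1..n} \<Longrightarrow> j \<in> {1..n} \<Longrightarrow> i < j \<Longrightarrow>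
      ({i, j} \<in> G \<longrightarrow> det2 x y i j = 1) \<and> ({i, j} \<notin> G \<longrightarrow> det2 x y i j > 1)"
    using ex_vectors_with_unit_dets[OF _ free] by blast
  define A where "A = Matrix.mat 2 n (\<lambda>(r, k). if r = 0 then x (k + 1) else y (k + 1))"
  have A: "A \<in> carrier_mat 2 n" by (simp add: A_def)
  have minor: "minor2 A {i, j} = det2 x y i j" if "1 \<le> i" "i < j" "j \<le> n" for i j
  proof -
    have "i - 1 < n" "j - 1 < n" "i - 1 + 1 = i" "j - 1 + 1 = j"
      using that by auto
    then show ?thesis
      unfolding minor2_eq[OF A that] det2_def by (simp add: A_def)
  qed
  have one: "minor2 A I = 1" if I: "I \<in> G" for I
  proof -
    obtain i j where ij: "I = {i, j}" "1 \<le> i" "i < j" "j \<le> n"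
      using edgesE[of I n] subsetD[OF G(1) I] by metis
    then have "det2 x y i j = 1" using xy[of i j] I by simp
    then show ?thesis using minor[OF ij(2-4)] ij(1) by simp
  qed
  have greater: "minor2 A K > 1" if K: "K \<in> edges n - G" for K
  proof -
    obtain i j where ij: "K = {i, j}" "1 \<le> i" "i < j" "j \<le> n"
      using edgesE[of K n] K by blast
    then have "det2 x y i j > 1" using xy[of i j] K by simp
    then show ?thesis using minor[OF ij(2-4)] ij(1) by simp
  qed
  have pos: "minor2 A I > 0" if "I \<in> edges n" for I
    using one[of I] greater[of I] that by (cases "I \<in> G") auto
  obtain P where P: "P \<in> Gr2_pos n" "A \<in> P"
    using ex_positive_point_if_minors_positive[OF n A pos] by blast
  show ?thesis
    unfolding smallest_minors_arrangement_def
  proof (intro conjI bexI[OF _ P(1)] bexI[OF _ P(2)] ballI)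
    show "minor2 A I = minor2 A I'" if "I \<in> G" "I' \<in> G" for I I'
      using one that by simp
    show "minor2 A I < minor2 A K" if "I \<in> G" "K \<in> edges n - G" for I K
      using one[OF that(1)] greater[OF that(2)] by simp
  qed (use G pos in auto)
qed

theorem theorem4p2:
  fixes n :: nat and p :: "nat \<Rightarrow> complex" and G :: "nat set set"
  assumes "n \<ge> 2"
    and "clockwise_on_circle n p"
    and "G \<subseteq> edges n"
    and "G \<noteq> {}"
  shows "smallest_minors_arrangement n G \<longleftrightarrow>
    (\<forall>e\<in>G. \<forall>f\<in>G. e \<noteq> f \<longrightarrow> non_crossing p e f \<or> e \<inter> f \<noteq> {})"
  using interleaving_free_if_smallest_minors smallest_minors_if_interleaving_free[OF assms(1,3,4)]
    interleaving_free_iff_non_crossing[OF assms(2,3)] by blast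

end
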